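(* Let $H$ be a layered graph, let $r$ be a positive integer, and let $G$ be a graph with chromatic number $\chi(G)=r+1$. Then there exists a positive integer $n$ such that $G^{\square n}\xrightarrow{r} H$.
   Context: Graphs are finite and simple. The Cartesian product $G\square H$ of graphs $G,H$ has vertex set $V(G)\times V(H)$, and $(x_1,x_2),(y_1,y_2)$ are adjacent iff either $x_1y_1\in E(G)$ and $x_2=y_2$, or $x_1=y_1$ and $x_2y_2\in E(H)$. The $n$-th Cartesian power is $G^{\square 1}=G$, $G^{\square n}=G^{\square (n-1)}\square G$ for $n\ge 2$; its vertices are identified with $n$-tuples of vertices of $G$. The hypercube is $Q_n=K_2^{\square n}$ with $V(K_2)=\{0,1\}$. The $i$-th vertex layer of $Q_n$ is the set of vertices with exactly $i$ ones; the $i$-th edge layer of $Q_n$ is the subgraph induced by the $i$-th and $(i+1)$-st vertex layers. A graph is layered if it is (isomorphic to) a subgraph of an edge layer of some hypercube. For positive integers $r,n$, $G^{\square n}\xrightarrow{r}H$ means that every coloring of the vertices of $G^{\square n}$ with $r$ colors contains a monochromatic copy of $H$, i.e. a (not necessarily induced) subgraph isomorphic to $H$ all of whose vertices have the same color. *)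

theory Defs
  imports
    "Graph_Theory.Pair_Digraph"
    "Graph_Theory.Digraph_Component"
    "Graph_Theory.Digraph_Isomorphism"
    "HOL-Library.FuncSet"
begin

text \<open>
  Finite simple graphs are values of type \<^typ>\<open>'a pair_pre_digraph\<close> satisfying
  \<^locale>\<open>pair_graph\<close> (finite, loop-free, with a symmetric set of arcs); an edge \<open>uv\<close> is the pair of arcs
  \<open>(u,v)\<close> and \<open>(v,u)\<close>.
\<close>

subsection \<open>Cartesian products and powers\<close>

definition cart_prod :: "'a pair_pre_digraph \<Rightarrow> 'b pair_pre_digraph \<Rightarrow> ('a \<times> 'b) pair_pre_digraph" where
  "cart_prod G H = \<lparr>
     pverts = pverts G \<times> pverts H,
     parcs = {((x1, x2), (y1, y2)) | x1 x2 y1 y2.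
        {x1, y1} \<subseteq> pverts G \<and> {x2, y2} \<subseteq> pverts H \<and>
        ((x1, y1) \<in> parcs G \<and> x2 = y2 \<or> x1 = y1 \<and> (x2, y2) \<in> parcs H)} \<rparr>"

definition relabel :: "('a \<Rightarrow> 'b) \<Rightarrow> 'a pair_pre_digraph \<Rightarrow> 'b pair_pre_digraph" where
  "relabel f G = \<lparr> pverts = f ` pverts G, parcs = map_prod f f ` parcs G \<rparr>"

text \<open>
  The vertices of the \<open>n\<close>-th power are the lists of length \<open>n\<close>: the pair \<open>(xs, x)\<close> is
  identified with \<open>xs @ [x]\<close>. The recursion starts at the one-vertex graph, so that the first
  power is \<open>G\<close> with each vertex \<open>x\<close> renamed to \<open>[x]\<close>; see \<open>cart_power_1\<close>.
\<close>

primrec cart_power :: "'a pair_pre_digraph \<Rightarrow> nat \<Rightarrow> 'a list pair_pre_digraph" where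
  "cart_power G 0 = \<lparr> pverts = {[]}, parcs = {} \<rparr>"
| "cart_power G (Suc n) = relabel (\<lambda>(xs, x). xs @ [x]) (cart_prod (cart_power G n) G)"

lemma cart_power_1:
  assumes "pair_wf_digraph G"
  shows "cart_power G 1 = relabel (\<lambda>x. [x]) G"
proof -
  interpret pair_wf_digraph G by fact
  have "parcs (cart_prod (cart_power G 0) G) = (\<lambda>(x, y). (([], x), ([], y))) ` parcs G"
    by (auto simp: cart_prod_def dest: in_arcsD1 in_arcsD2)
  moreover have "pverts (cart_prod (cart_power G 0) G) = Pair [] ` pverts G"
    by (auto simp: cart_prod_def)
  ultimately show ?thesis
    by (simp add: relabel_def image_image case_prod_beta map_prod_def)
qed

lemma pverts_cart_power:
  "pverts (cart_power G n) = {xs. length xs = n \<and> set xs \<subseteq> pverts G}"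
proof (induction n)
  case (Suc n)
  show ?case
  proof (intro set_eqI iffI)
    fix xs assume "xs \<in> {xs. length xs = Suc n \<and> set xs \<subseteq> pverts G}"
    then show "xs \<in> pverts (cart_power G (Suc n))"
      by (cases xs rule: rev_cases) (auto simp: relabel_def cart_prod_def Suc image_iff)
  qed (auto simp: relabel_def cart_prod_def Suc)
qed auto

lemma pair_graph_cart_prod:
  assumes "pair_graph G" "pair_graph H"
  shows "pair_graph (cart_prod G H)"
proof -
  interpret G: pair_graph G by fact
  interpret H: pair_graph H by fact
  have "parcs (cart_prod G H) \<subseteq> (pverts G \<times> pverts H) \<times> (pverts G \<times> pverts H)"
    by (auto simp: cart_prod_def)
  then have "finite (parcs (cart_prod G H))"
    by (rule finite_subset) simp
  then show ?thesis
    by unfold_locales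
       (auto simp: cart_prod_def symmetric_def intro!: symI
             dest: G.arcs_symmetric H.arcs_symmetric G.no_loops' H.no_loops')
qed

lemma pair_graph_relabel:
  assumes "pair_graph G" "inj_on f (pverts G)"
  shows "pair_graph (relabel f G)"
proof -
  interpret G: pair_graph G by fact
  have arcs: "(a, b) \<in> parcs (relabel f G) \<longleftrightarrow> (\<exists>u v. a = f u \<and> b = f v \<and> (u, v) \<in> parcs G)" for a b
    by (auto simp: relabel_def)
  have verts: "f u \<in> pverts (relabel f G)" if "u \<in> pverts G" for u
    using that by (simp add: relabel_def)
  have neq: "f u \<noteq> f v" if "(u, v) \<in> parcs G" for u v
    using that assms(2) G.no_loops' G.in_arcsD1 G.in_arcsD2 by (metis inj_onD)
  have sym: "sym (parcs (relabel f G))"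
    using G.arcs_symmetric by (intro symI) (auto simp: arcs)
  show ?thesis
  proof unfold_locales
    show "finite (pverts (relabel f G))" "finite (parcs (relabel f G))"
      using G.pair_finite_verts G.pair_finite_arcs by (simp_all add: relabel_def)
    show "symmetric (with_proj (relabel f G))"
      using sym by (simp add: symmetric_def)
    fix e assume e: "e \<in> parcs (relabel f G)"
    obtain a b where ab: "e = (a, b)" by (cases e)
    obtain u v where "a = f u" "b = f v" "(u, v) \<in> parcs G" using e ab arcs by auto
    then show "fst e \<in> pverts (relabel f G)" "snd e \<in> pverts (relabel f G)" "fst e \<noteq> snd e"
      using ab verts neq G.in_arcsD1 G.in_arcsD2 by auto
  qed
qed

lemma pair_graph_cart_power:
  assumes "pair_graph G"
  shows "pair_graph (cart_power G n)"
proof (induction n)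
  case 0
  show ?case by unfold_locales (auto simp: symmetric_def intro: symI)
next
  case (Suc n)
  then show ?case
    by (auto intro!: pair_graph_relabel pair_graph_cart_prod assms inj_onI)
qed

subsection \<open>Hypercubes and layered graphs\<close>

definition K2 :: "nat pair_pre_digraph" where
  "K2 = \<lparr> pverts = {0, 1}, parcs = {(0, 1), (1, 0)} \<rparr>"

definition hypercube :: "nat \<Rightarrow> nat list pair_pre_digraph" where
  "hypercube n = cart_power K2 n"

definition vertex_layer :: "nat \<Rightarrow> nat \<Rightarrow> nat list set" where
  "vertex_layer n i = {x \<in> pverts (hypercube n). count_list x 1 = i}"

definition edge_layer :: "nat \<Rightarrow> nat \<Rightarrow> (nat list, nat list \<times> nat list) pre_digraph" where
  "edge_layer n i = with_proj (hypercube n) \<restriction> (vertex_layer n i \<union> vertex_layer n (i + 1))"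

text \<open>
  In the next definition and in \<open>vertex_arrows\<close>, \<open>subgraph\<close> alone would allow directed \<open>S\<close>, but
  \<open>S\<close> is isomorphic to \<open>H\<close> and hence symmetric whenever \<open>H\<close> is a graph.
\<close>

definition layered :: "'a pair_pre_digraph \<Rightarrow> bool" where
  "layered H \<longleftrightarrow>
     (\<exists>n i S. n > 0 \<and> i < n \<and> subgraph S (edge_layer n i) \<and> digraph_iso (with_proj H) S)"

subsection \<open>Colorings\<close>

definition proper_coloring :: "'a pair_pre_digraph \<Rightarrow> nat \<Rightarrow> ('a \<Rightarrow> nat) \<Rightarrow> bool" where
  "proper_coloring G k c \<longleftrightarrow> c \<in> pverts G \<rightarrow> {..<k} \<and> (\<forall>(u, v) \<in> parcs G. c u \<noteq> c v)"

definition chromatic_number :: "'a pair_pre_digraph \<Rightarrow> nat" where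
  "chromatic_number G = (LEAST k. \<exists>c. proper_coloring G k c)"

lemma ex_proper_coloring:
  assumes "pair_graph G"
  shows "\<exists>k c. proper_coloring G k c"
proof -
  interpret pair_graph G by fact
  obtain c :: "'a \<Rightarrow> nat" and k where "c ` pverts G = {i. i < k}" "inj_on c (pverts G)"
    using finite_imp_inj_to_nat_seg[OF pair_finite_verts] by metis
  then have "proper_coloring G k c"
    by (auto simp: proper_coloring_def dest: in_arcsD1 in_arcsD2 no_loops' inj_onD)
  then show ?thesis by blast
qed

text \<open>\<open>vertex_arrows F r H\<close> is \<open>F \<rightarrow> H\<close> with \<open>r\<close> written over the arrow.\<close>

definition vertex_arrows :: "'a pair_pre_digraph \<Rightarrow> nat \<Rightarrow> 'b pair_pre_digraph \<Rightarrow> bool" where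
  "vertex_arrows F r H \<longleftrightarrow>
     (\<forall>c \<in> pverts F \<rightarrow> {..<r}.
        \<exists>S. subgraph S (with_proj F) \<and> digraph_iso (with_proj H) S \<and>
            (\<exists>k<r. \<forall>v \<in> verts S. c v = k))"

end

theory Submission
  imports
    Defs
    "HOL-Library.Ramsey"
begin

text \<open>
  Let \<open>H\<close> lie in the edge layer of \<open>Q\<^sub>k\<close> between sizes \<open>s\<close> and \<open>s + 1\<close>. Such an edge layer
  sits in a power of \<open>G\<close> whenever \<open>k\<close> coordinates are left free, the others are given fixed
  letters, and the free ones range over the two ends of one edge \<open>xy\<close> of \<open>G\<close>. Suppose that a
  coloring \<open>\<chi>\<close> of all words of a huge length \<open>n\<close> over \<open>V(G)\<close> makes no such layer monochromatic.
  The claim is that some single coordinate, the others being fixed suitably, then shows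
  a proper coloring of \<open>G\<close>; as \<open>r\<close> colors do not suffice for that, this is absurd.

  The edges of \<open>G\<close> are treated one at a time. Given an edge \<open>xy\<close>, fill the word with
  the letter \<open>x\<close> and write patterns of a fixed length \<open>N\<close> on \<open>N\<close>-element sets of positions. By
  Ramsey's theorem there is a large set of positions in which the color depends on the
  pattern only (\<open>ramsey_words\<close>). In a pattern, call a position a site if it directly follows a
  run of \<open>s\<close> letters \<open>y\<close>. If a site holds \<open>y\<close>, the run becomes \<open>y^(s + 1)\<close>, and this run may be spread
  over any \<open>s + 1\<close> of \<open>k\<close> consecutive available positions; if it holds \<open>x\<close>, the run is
  spread over any \<open>s\<close> of them, the letter \<open>x\<close> being invisible against the background. So
  these words form an edge layer (\<open>layer_in_words\<close>), with one color on each side, and the two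
  colors must differ. Hence exchanging \<open>x\<close> and \<open>y\<close> at a site always changes the color.

  The blocks \<open>y^s\<close> followed by a site can be repeated as often as desired, so that the sites are
  the free coordinates of a subcube of any prescribed dimension (\<open>separate_edge\<close>). The
  sites may carry arbitrary letters, and the property just obtained survives in every
  subcube, so the argument can be repeated inside for the next edge
  (\<open>separate_edges\<close>). After all edges, one remaining free coordinate gives the
  proper coloring.
\<close>

section \<open>Subcubes of the space of words\<close>

text \<open>
  A word of length \<open>n\<close> is a function on the natural numbers of which only the values below \<open>n\<close> are
  constrained to be letters. A subcube is given by its parametrization: the \<open>t\<close>-th parameter
  is written at position \<open>p t\<close>, and all other positions carry the fixed word \<open>b\<close>. That \<open>\<Phi>\<close> is
  determined also beyond \<open>n\<close> allows equations between whole functions.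
\<close>

definition subcube :: "'a set \<Rightarrow> nat \<Rightarrow> nat \<Rightarrow> ((nat \<Rightarrow> 'a) \<Rightarrow> nat \<Rightarrow> 'a) \<Rightarrow> bool" where
  "subcube V n k \<Phi> \<longleftrightarrow>
     (\<exists>p b. inj_on p {..<k} \<and> p \<in> {..<k} \<rightarrow> {..<n} \<and> b \<in> {..<n} \<rightarrow> V \<and>
        (\<forall>w. \<forall>t<k. \<Phi> w (p t) = w t) \<and> (\<forall>w. \<forall>i. i \<notin> p ` {..<k} \<longrightarrow> \<Phi> w i = b i))"

lemma subcubeE:
  assumes "subcube V n k \<Phi>"
  obtains p b where "inj_on p {..<k}" "p \<in> {..<k} \<rightarrow> {..<n}" "b \<in> {..<n} \<rightarrow> V"
    "\<And>w t. t < k \<Longrightarrow> \<Phi> w (p t) = w t" "\<And>w i. i \<notin> p ` {..<k} \<Longrightarrow> \<Phi> w i = b i"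
  using assms unfolding subcube_def by blast

lemma subcube_cong:
  assumes "subcube V n k \<Phi>" and "\<And>t. t < k \<Longrightarrow> w t = w' t"
  shows "\<Phi> w = \<Phi> w'"
proof
  fix i
  obtain p b where "inj_on p {..<k}" "p \<in> {..<k} \<rightarrow> {..<n}" "b \<in> {..<n} \<rightarrow> V"
    and p: "\<And>w t. t < k \<Longrightarrow> \<Phi> w (p t) = w t" and b: "\<And>w i. i \<notin> p ` {..<k} \<Longrightarrow> \<Phi> w i = b i"
    by (rule subcubeE[OF assms(1)]) blast
  show "\<Phi> w i = \<Phi> w' i"
  proof (cases "i \<in> p ` {..<k}")
    case True
    then show ?thesis using p assms(2) by auto
  qed (simp add: b)
qed

lemma subcube_words:
  assumes "subcube V n k \<Phi>" and "w \<in> {..<k} \<rightarrow> V"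
  shows "\<Phi> w \<in> {..<n} \<rightarrow> V"
proof
  fix i assume i: "i \<in> {..<n}"
  obtain p b where "inj_on p {..<k}" "p \<in> {..<k} \<rightarrow> {..<n}" and bV: "b \<in> {..<n} \<rightarrow> V"
    and p: "\<And>w t. t < k \<Longrightarrow> \<Phi> w (p t) = w t" and b: "\<And>w i. i \<notin> p ` {..<k} \<Longrightarrow> \<Phi> w i = b i"
    by (rule subcubeE[OF assms(1)]) blast
  show "\<Phi> w i \<in> V"
  proof (cases "i \<in> p ` {..<k}")
    case True
    then show ?thesis using p assms(2) by auto
  qed (use b bV i in auto)
qed

lemma subcube_comp:
  assumes "subcube V n m \<Phi>" and "subcube V m k \<Psi>"
  shows "subcube V n k (\<Phi> \<circ> \<Psi>)"
proof -
  obtain p b where p: "inj_on p {..<m}" "p \<in> {..<m} \<rightarrow> {..<n}" "b \<in> {..<n} \<rightarrow> V"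
    "\<And>w t. t < m \<Longrightarrow> \<Phi> w (p t) = w t" "\<And>w i. i \<notin> p ` {..<m} \<Longrightarrow> \<Phi> w i = b i"
    by (rule subcubeE[OF assms(1)]) blast
  obtain q c where q: "inj_on q {..<k}" "q \<in> {..<k} \<rightarrow> {..<m}" "c \<in> {..<m} \<rightarrow> V"
    "\<And>w t. t < k \<Longrightarrow> \<Psi> w (q t) = w t" "\<And>w i. i \<notin> q ` {..<k} \<Longrightarrow> \<Psi> w i = c i"
    by (rule subcubeE[OF assms(2)]) blast
  have "inj_on (p \<circ> q) {..<k}"
    using q(1,2) p(1) by (intro comp_inj_on inj_on_subset[OF p(1)]) auto
  moreover have "p \<circ> q \<in> {..<k} \<rightarrow> {..<n}"
    using p(2) q(2) by (auto simp: Pi_iff)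
  moreover have "\<Phi> c \<in> {..<n} \<rightarrow> V"
    using assms(1) q(3) by (rule subcube_words)
  moreover have "(\<Phi> \<circ> \<Psi>) w ((p \<circ> q) t) = w t" if "t < k" for w t
    using that p(4) q(2,4) by (auto simp: Pi_iff)
  moreover have "(\<Phi> \<circ> \<Psi>) w i = \<Phi> c i" if "i \<notin> (p \<circ> q) ` {..<k}" for w i
  proof (cases "i \<in> p ` {..<m}")
    case True
    then obtain j where j: "i = p j" "j < m" by auto
    then have "j \<notin> q ` {..<k}" using that by auto
    then show ?thesis using j p(4) q(5) by simp
  qed (simp add: p(5))
  ultimately show ?thesis unfolding subcube_def by blast
qed

text \<open>
  The letter \<open>v\<close> beyond \<open>k\<close> is a dummy: outside the free positions a subcube must not depend on its
  parameters.
\<close>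

lemma subcube_id:
  assumes "v \<in> V"
  shows "subcube V k k (\<lambda>w i. if i < k then w i else v)"
  unfolding subcube_def
  by (rule exI[of _ id], rule exI[of _ "\<lambda>_. v"]) (use assms in auto)

lemma subcube_update:
  assumes "subcube V n k \<Phi>"
  obtains p where "p \<in> {..<k} \<rightarrow> {..<n}" "\<And>w t a. t < k \<Longrightarrow> \<Phi> (w(t := a)) = (\<Phi> w)(p t := a)"
proof -
  obtain p b where p: "inj_on p {..<k}" "p \<in> {..<k} \<rightarrow> {..<n}"
    "\<And>w t. t < k \<Longrightarrow> \<Phi> w (p t) = w t" "\<And>w i. i \<notin> p ` {..<k} \<Longrightarrow> \<Phi> w i = b i"
    by (rule subcubeE[OF assms(1)]) blast
  have "\<Phi> (w(t := a)) i = ((\<Phi> w)(p t := a)) i" if "t < k" for w t a i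
  proof (cases "i \<in> p ` {..<k}")
    case True
    then obtain j where "i = p j" "j < k" by auto
    then show ?thesis using that p(3) inj_onD[OF p(1), of j t] by auto
  next
    case False
    then show ?thesis using that p(4) by auto
  qed
  then show thesis using that p(2) by blast
qed

section \<open>Ramsey's theorem for words\<close>

lemma ramsey_finite_palette:
  assumes "finite C"
  shows "\<exists>n::nat. \<forall>f \<in> nsets {..<n} N \<rightarrow> C. \<exists>Y \<in> nsets {..<n} L. \<exists>c. f ` nsets Y N \<subseteq> {c}"
proof -
  obtain h :: "'a \<Rightarrow> nat" where h: "bij_betw h C {0..<card C}"
    using assms ex_bij_betw_finite_nat by blast
  obtain n :: nat where n: "partn_lst {..<n} (replicate (card C) L) N"
    using ramsey_full by blast
  have "\<exists>Y \<in> nsets {..<n} L. \<exists>c. f ` nsets Y N \<subseteq> {c}" if f: "f \<in> nsets {..<n} N \<rightarrow> C" for f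
  proof -
    have "h \<circ> f \<in> nsets {..<n} N \<rightarrow> {..<card C}"
      using f h by (fastforce simp: bij_betw_def Pi_iff)
    then obtain i Y where i: "i < card C" and Y: "Y \<in> nsets {..<n} L" "(h \<circ> f) ` nsets Y N \<subseteq> {i}"
      using n by (elim partn_lstE) auto
    have "nsets Y N \<subseteq> nsets {..<n} N"
      using Y(1) by (intro nsets_mono) (auto simp: nsets_def)
    have "f A = inv_into C h i" if A: "A \<in> nsets Y N" for A
    proof -
      have "f A \<in> C" using f A \<open>nsets Y N \<subseteq> nsets {..<n} N\<close> by blast
      moreover have "h (f A) = i" using Y(2) A by auto
      ultimately show ?thesis using inv_into_f_f[OF bij_betw_imp_inj_on[OF h]] by metis
    qed
    then show ?thesis using Y(1) by blast
  qed
  then show ?thesis by blast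
qed

text \<open>
  The pattern \<open>p\<close> written in increasing order on the positions in \<open>A\<close>, on a background of \<open>x\<close>;
  the index into \<open>p\<close> is the rank of the position in \<open>A\<close>.
\<close>

definition place :: "'a \<Rightarrow> nat set \<Rightarrow> (nat \<Rightarrow> 'a) \<Rightarrow> nat \<Rightarrow> 'a" where
  "place x A p i = (if i \<in> A then p (card (A \<inter> {..<i})) else x)"

lemma card_below_less:
  fixes i :: nat
  assumes "finite A" "i \<in> A"
  shows "card (A \<inter> {..<i}) < card A"
  using assms by (intro psubset_card_mono) auto

lemma place_words:
  assumes "x \<in> V" "p \<in> {..<N} \<rightarrow> V" "A \<in> nsets S N"
  shows "place x A p \<in> I \<rightarrow> V"
  using assms card_below_less[of A] by (auto simp: place_def nsets_def Pi_iff)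

lemma place_cong:
  assumes "A \<in> nsets S N" "\<And>j. j < N \<Longrightarrow> p j = q j"
  shows "place x A p = place x A q"
  using assms card_below_less[of A] by (auto simp: place_def nsets_def)

text \<open>
  Coloring each \<open>N\<close>-set \<open>A\<close> of positions by the whole table that maps a pattern to the color of that
  pattern on \<open>A\<close> uses finitely many colors, so a single application of Ramsey's theorem
  handles all patterns at once. The subcube has the homogeneous set as its free positions,
  taken in increasing order so that ranks are preserved, and \<open>x\<close> everywhere else.
\<close>

lemma ramsey_words:
  assumes V: "finite V" and x: "x \<in> V"
  shows "\<exists>n. \<forall>\<chi> \<in> ({..<n} \<rightarrow> V) \<rightarrow> {..<r::nat}. \<exists>\<Phi>. subcube V n L \<Phi> \<and>
           (\<forall>p \<in> {..<N} \<rightarrow> V. \<forall>A \<in> nsets {..<L} N. \<forall>B \<in> nsets {..<L} N.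
              \<chi> (\<Phi> (place x A p)) = \<chi> (\<Phi> (place x B p)))"
proof -
  let ?P = "{..<N} \<rightarrow>\<^sub>E V"
  let ?C = "?P \<rightarrow>\<^sub>E {..<r}"
  have "finite ?C" using V by (intro finite_PiE) auto
  then obtain n :: nat where n: "\<forall>f \<in> nsets {..<n} N \<rightarrow> ?C. \<exists>Y \<in> nsets {..<n} L. \<exists>c. f ` nsets Y N \<subseteq> {c}"
    using ramsey_finite_palette[of ?C N L] by blast
  have "\<exists>\<Phi>. subcube V n L \<Phi> \<and>
           (\<forall>p \<in> {..<N} \<rightarrow> V. \<forall>A \<in> nsets {..<L} N. \<forall>B \<in> nsets {..<L} N.
              \<chi> (\<Phi> (place x A p)) = \<chi> (\<Phi> (place x B p)))"
    if \<chi>: "\<chi> \<in> ({..<n} \<rightarrow> V) \<rightarrow> {..<r}" for \<chi>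
  proof -
    define f where "f A = (\<lambda>p\<in>?P. \<chi> (place x A p))" for A
    have "f \<in> nsets {..<n} N \<rightarrow> ?C"
    proof
      fix A assume A: "A \<in> nsets {..<n} N"
      have "\<chi> (place x A p) \<in> {..<r}" if "p \<in> ?P" for p
      proof -
        have "p \<in> {..<N} \<rightarrow> V" using that by auto
        then have "place x A p \<in> {..<n} \<rightarrow> V" using x A by (intro place_words)
        then show ?thesis using \<chi> by (rule Pi_mem[rotated])
      qed
      then show "f A \<in> ?C" unfolding f_def by (intro restrict_PiE_iff[THEN iffD2] ballI)
    qed
    then obtain Y c where Y: "Y \<in> nsets {..<n} L" and c: "f ` nsets Y N \<subseteq> {c}"
      using n by blast
    have fin: "finite Y" and cY: "card Y = L" and Yn: "Y \<subseteq> {..<n}" using Y by (auto simp: nsets_def)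
    define m where "m t = sorted_list_of_set Y ! t" for t
    have mono: "m s < m t" if "s < t" "t < L" for s t
      using that sorted_wrt_nth_less[OF strict_sorted_list_of_set[of Y], of s t] cY
      unfolding m_def by simp
    have bij: "bij_betw m {..<L} Y"
      using bij_betw_nth[of "sorted_list_of_set Y" "{..<L}" Y] fin cY
      unfolding m_def by simp
    then have inj: "inj_on m {..<L}" and im: "m ` {..<L} = Y" by (auto simp: bij_betw_def)
    have less_iff: "m s < m t \<longleftrightarrow> s < t" if "s < L" "t < L" for s t
      using mono[of s t] mono[of t s] that by (cases s t rule: linorder_cases) auto
    define \<Phi> where "\<Phi> u i = (if i \<in> Y then u (the_inv_into {..<L} m i) else x)" for u i
    have \<Phi>m: "\<Phi> u (m t) = u t" if "t < L" for u t
      using that im the_inv_into_f_f[OF inj] by (auto simp: \<Phi>_def)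
    have "subcube V n L \<Phi>"
      unfolding subcube_def
    proof (intro exI conjI)
      show "inj_on m {..<L}" "m \<in> {..<L} \<rightarrow> {..<n}" "(\<lambda>_. x) \<in> {..<n} \<rightarrow> V"
        using inj im Yn x by auto
      show "\<forall>w. \<forall>t<L. \<Phi> w (m t) = w t" using \<Phi>m by blast
      show "\<forall>w i. i \<notin> m ` {..<L} \<longrightarrow> \<Phi> w i = x" unfolding im by (simp add: \<Phi>_def)
    qed
    have place: "\<Phi> (place x A p) = place x (m ` A) p" if A: "A \<in> nsets {..<L} N" for A p
    proof
      fix i
      show "\<Phi> (place x A p) i = place x (m ` A) p i"
      proof (cases "i \<in> Y")
        case True
        then obtain t where t: "t < L" "i = m t" using im by auto
        have AL: "A \<subseteq> {..<L}" using A by (auto simp: nsets_def)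
        then have mem: "m t \<in> m ` A \<longleftrightarrow> t \<in> A"
          using t inj by (meson inj_on_image_mem_iff lessThan_iff)
        have "m ` A \<inter> {..<m t} = m ` (A \<inter> {..<t})"
          using AL t less_iff by auto
        then have "card (m ` A \<inter> {..<m t}) = card (A \<inter> {..<t})"
          using AL inj by (simp add: card_image inj_on_subset le_infI1)
        then show ?thesis using t \<Phi>m mem by (simp add: place_def)
      next
        case False
        then show ?thesis using A im by (auto simp: place_def \<Phi>_def nsets_def)
      qed
    qed
    have "\<chi> (\<Phi> (place x A p)) = c (restrict p {..<N})"
      if A: "A \<in> nsets {..<L} N" and p: "p \<in> {..<N} \<rightarrow> V" for A p
    proof -
      have mA: "m ` A \<in> nsets Y N"
        using A im inj by (auto simp: nsets_def card_image inj_on_subset)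
      then have "f (m ` A) = c" using c by blast
      moreover have "restrict p {..<N} \<in> ?P" using p by auto
      ultimately have "c (restrict p {..<N}) = \<chi> (place x (m ` A) (restrict p {..<N}))"
        unfolding f_def by auto
      also have "place x (m ` A) (restrict p {..<N}) = place x (m ` A) p"
        using mA by (rule place_cong) simp
      finally show ?thesis by (simp only: place[OF A])
    qed
    then show ?thesis using \<open>subcube V n L \<Phi>\<close> by (intro exI[of _ \<Phi>]) simp
  qed
  then show ?thesis by blast
qed

section \<open>Layers among words\<close>

text \<open>
  The \<open>N + k\<close> positions are used as follows: the first \<open>l\<close> hold the start of the pattern, the next
  \<open>k\<close> are the free coordinates of the layer, one position after them always holds \<open>x\<close>, and
  then comes the part of the pattern behind the site; \<open>s\<close> positions remain as background. A set \<open>T\<close> of \<open>s + 1\<close> free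
  coordinates holding \<open>y\<close> accounts for the run and the site. A set of only \<open>s\<close> accounts for the run;
  the site is then the extra position, which is there to keep the pattern at length \<open>N\<close>.
\<close>

lemma layer_in_words:
  assumes V: "x \<in> V" "y \<in> V" and p: "p \<in> {..<N} \<rightarrow> V"
    and run: "\<And>j. l \<le> j \<Longrightarrow> j < l + s \<Longrightarrow> p j = y" and N: "l + s < N"
  obtains \<Psi> where "subcube V (N + k) k \<Psi>"
    and "\<And>T. T \<subseteq> {..<k} \<Longrightarrow> card T = s \<Longrightarrow>
      \<exists>A \<in> nsets {..<N + k} N. \<Psi> (\<lambda>j. if j \<in> T then y else x) = place x A (p(l + s := x))"
    and "\<And>T. T \<subseteq> {..<k} \<Longrightarrow> card T = Suc s \<Longrightarrow>
      \<exists>A \<in> nsets {..<N + k} N. \<Psi> (\<lambda>j. if j \<in> T then y else x) = place x A (p(l + s := y))"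
proof -
  define b where "b i = (if i < l then p i else if l + k < i \<and> i < N + k - s then p (i + s - k) else x)" for i
  define \<Psi> where "\<Psi> w i = (if l \<le> i \<and> i < l + k then w (i - l) else b i)" for w :: "nat \<Rightarrow> 'a" and i
  have "b \<in> {..<N + k} \<rightarrow> V"
    using V p N by (auto simp: b_def Pi_iff)
  moreover have "i \<in> (+) l ` {..<k}" if "l \<le> i" "i < l + k" for i
    using that by (intro image_eqI[of _ _ "i - l"]) auto
  ultimately have "subcube V (N + k) k \<Psi>"
    unfolding subcube_def
    by (intro exI[of _ "(+) l"] exI[of _ b]) (use N in \<open>auto simp: \<Psi>_def\<close>)
  moreover
  {
    fix T z
    assume T: "T \<subseteq> {..<k}" and sz: "card T = s \<and> z = x \<or> card T = Suc s \<and> z = y"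
    (* the extra position, needed as the site only for sets of the smaller size *)
    define E where "E = (if card T = s then {l + k} else {})"
    define A where "A = {..<l} \<union> (+) l ` T \<union> E \<union> {Suc (l + k)..<N + k - s}"
    have finT: "finite T" using T finite_subset by blast
    have cT: "card T + card E = Suc s" using sz by (auto simp: E_def)
    have cl: "card ({..<l} \<union> (+) l ` U \<union> F) = l + card U + card F"
      if "U \<subseteq> T" "F \<subseteq> E" for U F
    proof -
      have "finite U" "finite F" using that finT finite_subset by (auto simp: E_def split: if_splits)
      moreover have "({..<l} \<union> (+) l ` U) \<inter> F = {}" "{..<l} \<inter> (+) l ` U = {}"
        using that T by (fastforce simp: E_def split: if_splits)+
      ultimately show ?thesis by (simp add: card_Un_disjoint card_image)
    qed
    have tail: "card ({..<l} \<union> (+) l ` T \<union> E \<union> {Suc (l + k)..<i}) = Suc (l + s) + (i - Suc (l + k))" for i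
    proof -
      have "({..<l} \<union> (+) l ` T \<union> E) \<inter> {Suc (l + k)..<i} = {}"
        using T by (auto simp: E_def)
      moreover have "finite ({..<l} \<union> (+) l ` T \<union> E)" using finT by (auto simp: E_def)
      ultimately show ?thesis using cl[of T E] cT by (simp add: card_Un_disjoint)
    qed
    have "A \<subseteq> {..<N + k}"
      using T N by (auto simp: A_def E_def split: if_splits)
    moreover have "card A = N"
      using tail[of "N + k - s"] N by (simp add: A_def)
    ultimately have A: "A \<in> nsets {..<N + k} N"
      by (auto simp: nsets_def finite_subset)
    have "\<Psi> (\<lambda>j. if j \<in> T then y else x) i = place x A (p(l + s := z)) i" for i
    proof -
      consider (1) "i < l" | (2) j where "i = l + j" "j < k" | (3) "i = l + k"
        | (4) "l + k < i" "i < N + k - s" | (5) "l + k < i" "i \<ge> N + k - s"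
      proof -
        have "i < l \<or> (i = l + (i - l) \<and> i - l < k) \<or> i = l + k \<or> l + k < i" by linarith
        then show thesis using that by (metis not_less)
      qed
      then show ?thesis
      proof cases
        case 1
        then have "A \<inter> {..<i} = {..<i}" by (auto simp: A_def)
        then show ?thesis using 1 by (auto simp: \<Psi>_def b_def place_def A_def)
      next
        case 2
        have mem: "i \<in> A \<longleftrightarrow> j \<in> T" using 2 by (auto simp: A_def E_def split: if_splits)
        have "A \<inter> {..<i} = {..<l} \<union> (+) l ` (T \<inter> {..<j}) \<union> {}"
          using 2 T by (auto simp: A_def E_def split: if_splits)
        then have c: "card (A \<inter> {..<i}) = l + card (T \<inter> {..<j})"
          using cl[of "T \<inter> {..<j}" "{}"] by simp
        have "(p(l + s := z)) (l + card (T \<inter> {..<j})) = y" if "j \<in> T"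
        proof -
          have "card (T \<inter> {..<j}) < card T" using that finT by (rule card_below_less[rotated])
          then show ?thesis using sz run by auto
        qed
        then show ?thesis using 2 mem c by (simp add: \<Psi>_def place_def)
      next
        case 3
        have mem: "i \<in> A \<longleftrightarrow> card T = s" using 3 T by (auto simp: A_def E_def split: if_splits)
        have "A \<inter> {..<i} = {..<l} \<union> (+) l ` T \<union> {}"
          using 3 T by (auto simp: A_def E_def split: if_splits)
        then have "card (A \<inter> {..<i}) = l + card T"
          using cl[of T "{}"] by simp
        then show ?thesis using 3 mem sz by (auto simp: \<Psi>_def b_def place_def)
      next
        case 4
        have "A \<inter> {..<i} = {..<l} \<union> (+) l ` T \<union> E \<union> {Suc (l + k)..<i}"
          using 4 T by (auto simp: A_def E_def split: if_splits)
        then have "card (A \<inter> {..<i}) = i + s - k"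
          using tail[of i] 4 by simp
        moreover have "i \<in> A" using 4 by (auto simp: A_def)
        moreover have "i + s - k \<noteq> l + s" using 4 by simp
        ultimately show ?thesis using 4 by (simp add: \<Psi>_def b_def place_def)
      next
        case 5
        then have "i \<notin> A" using T by (auto simp: A_def E_def split: if_splits)
        then show ?thesis using 5 by (simp add: \<Psi>_def b_def place_def)
      qed
    qed
    then have "\<exists>A \<in> nsets {..<N + k} N. \<Psi> (\<lambda>j. if j \<in> T then y else x) = place x A (p(l + s := z))"
      using A by blast
  }
  ultimately show thesis using that by metis
qed

section \<open>Separating the ends of the edges\<close>

definition mono_layer ::
  "'a set \<Rightarrow> ('a \<times> 'a) set \<Rightarrow> nat \<Rightarrow> nat \<Rightarrow> nat \<Rightarrow> ((nat \<Rightarrow> 'a) \<Rightarrow> nat) \<Rightarrow> bool" where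
  "mono_layer V E n k s \<chi> \<longleftrightarrow>
     (\<exists>\<Psi> x y c. subcube V n k \<Psi> \<and> (x, y) \<in> E \<and>
        (\<forall>T \<subseteq> {..<k}. card T = s \<or> card T = Suc s \<longrightarrow> \<chi> (\<Psi> (\<lambda>j. if j \<in> T then y else x)) = c))"

text \<open>
  Quantifying over all words \<open>w\<close>, and not only over some, is what makes this property pass to
  subcubes.
\<close>

definition separates :: "'a set \<Rightarrow> nat \<Rightarrow> ((nat \<Rightarrow> 'a) \<Rightarrow> nat) \<Rightarrow> 'a \<times> 'a \<Rightarrow> bool" where
  "separates V k \<chi> = (\<lambda>(x, y). \<forall>w \<in> {..<k} \<rightarrow> V. \<forall>t<k. \<chi> (w(t := x)) \<noteq> \<chi> (w(t := y)))"

lemma mono_layer_subcube: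
  assumes "subcube V n m \<Phi>" "mono_layer V E m k s (\<chi> \<circ> \<Phi>)"
  shows "mono_layer V E n k s \<chi>"
proof -
  obtain \<Psi> x y c where \<Psi>: "subcube V m k \<Psi>" and E: "(x, y) \<in> E"
    and c: "\<And>T. T \<subseteq> {..<k} \<Longrightarrow> card T = s \<or> card T = Suc s \<Longrightarrow>
      (\<chi> \<circ> \<Phi>) (\<Psi> (\<lambda>j. if j \<in> T then y else x)) = c"
    using assms(2) unfolding mono_layer_def by blast
  show ?thesis
    unfolding mono_layer_def
    by (rule exI[of _ "\<Phi> \<circ> \<Psi>"], intro exI[of _ x] exI[of _ y] exI[of _ c])
       (use subcube_comp[OF assms(1) \<Psi>] E c in auto)
qed

lemma separates_subcube:
  assumes "subcube V m k \<Phi>" "separates V m \<chi> e"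
  shows "separates V k (\<chi> \<circ> \<Phi>) e"
proof -
  obtain p where p: "p \<in> {..<k} \<rightarrow> {..<m}" "\<And>w t a. t < k \<Longrightarrow> \<Phi> (w(t := a)) = (\<Phi> w)(p t := a)"
    by (rule subcube_update[OF assms(1)]) blast
  show ?thesis
    using assms(2) subcube_words[OF assms(1)] p(1)
    unfolding separates_def by (auto simp: p(2) Pi_iff)
qed

text \<open>
  The subcube consists of \<open>K\<close> blocks of length \<open>s + 1\<close>, each a run of \<open>s\<close> letters \<open>y\<close> followed by a site.
  If some site could be switched between \<open>x\<close> and \<open>y\<close> without changing the color, then
  \<open>layer_in_words\<close> would give a monochromatic layer.
\<close>

lemma separate_edge:
  assumes V: "finite V" and E: "(x, y) \<in> E" "E \<subseteq> V \<times> V"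
  shows "\<exists>n. \<forall>\<chi> \<in> ({..<n} \<rightarrow> V) \<rightarrow> {..<r}. mono_layer V E n k s \<chi> \<or>
           (\<exists>\<Phi>. subcube V n K \<Phi> \<and> separates V K (\<chi> \<circ> \<Phi>) (x, y))"
proof -
  have xV: "x \<in> V" and yV: "y \<in> V" using E by auto
  define N where "N = K * Suc s"
  obtain n where n: "\<forall>\<chi> \<in> ({..<n} \<rightarrow> V) \<rightarrow> {..<r}. \<exists>\<Theta>. subcube V n (N + k) \<Theta> \<and>
           (\<forall>p \<in> {..<N} \<rightarrow> V. \<forall>A \<in> nsets {..<N + k} N. \<forall>B \<in> nsets {..<N + k} N.
              \<chi> (\<Theta> (place x A p)) = \<chi> (\<Theta> (place x B p)))"
    using ramsey_words[OF V xV, of r "N + k" N] by (rule exE)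
  define pat where "pat w j = (if j mod Suc s = s then w (j div Suc s) else y)" for w :: "nat \<Rightarrow> 'a" and j
  define \<Omega> where "\<Omega> w = place x {..<N} (pat w)" for w
  have \<Omega>_eq: "\<Omega> w i = (if i < N then pat w i else x)" for w i
  proof -
    have "i < N \<Longrightarrow> {..<N} \<inter> {..<i} = {..<i}" by auto
    then show ?thesis by (simp add: \<Omega>_def place_def)
  qed
  have site: "t * Suc s + s < N" if "t < K" for t
  proof -
    have "Suc t * Suc s \<le> K * Suc s" using that by (intro mult_le_mono1) simp
    then show ?thesis unfolding N_def by simp
  qed
  have site_div: "(t * Suc s + s) div Suc s = t" for t
    by (rule div_nat_eqI) (simp_all add: algebra_simps)
  have site_mod: "(t * Suc s + s) mod Suc s = s" for t
    by (subst mod_mult_self3) simp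
  have cube: "subcube V (N + k) K \<Omega>"
    unfolding subcube_def
  proof (intro exI conjI)
    let ?q = "\<lambda>t. t * Suc s + s"
    show "inj_on ?q {..<K}" by (rule inj_on_inverseI[of _ "\<lambda>i. i div Suc s"]) (rule site_div)
    show "?q \<in> {..<K} \<rightarrow> {..<N + k}" using trans_less_add1[OF site] by blast
    show "(\<lambda>i. if i < N then y else x) \<in> {..<N + k} \<rightarrow> V" using xV yV by auto
    show "\<forall>w. \<forall>t<K. \<Omega> w (?q t) = w t"
      unfolding \<Omega>_eq pat_def site_div site_mod using site by auto
    show "\<forall>w i. i \<notin> ?q ` {..<K} \<longrightarrow> \<Omega> w i = (if i < N then y else x)"
    proof (intro allI impI)
      fix w i assume i: "i \<notin> ?q ` {..<K}"
      have "i mod Suc s \<noteq> s" if "i < N"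
      proof
        assume "i mod Suc s = s"
        then have "i = ?q (i div Suc s)" by (metis div_mult_mod_eq)
        moreover have "i div Suc s < K" using that unfolding N_def by (rule less_mult_imp_div_less)
        ultimately show False using i by blast
      qed
      then show "\<Omega> w i = (if i < N then y else x)" by (simp add: \<Omega>_eq pat_def)
    qed
  qed
  have "mono_layer V E n k s \<chi> \<or> (\<exists>\<Phi>. subcube V n K \<Phi> \<and> separates V K (\<chi> \<circ> \<Phi>) (x, y))"
    if \<chi>: "\<chi> \<in> ({..<n} \<rightarrow> V) \<rightarrow> {..<r}" for \<chi>
  proof -
    obtain \<Theta> where \<Theta>: "subcube V n (N + k) \<Theta>"
      and hom: "\<And>p A B. p \<in> {..<N} \<rightarrow> V \<Longrightarrow> A \<in> nsets {..<N + k} N \<Longrightarrow> B \<in> nsets {..<N + k} N \<Longrightarrow>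
         \<chi> (\<Theta> (place x A p)) = \<chi> (\<Theta> (place x B p))"
      using bspec[OF n \<chi>] by (elim exE conjE) blast
    show ?thesis
    proof (cases "separates V K (\<chi> \<circ> (\<Theta> \<circ> \<Omega>)) (x, y)")
      case True
      then show ?thesis using subcube_comp[OF \<Theta> cube] by blast
    next
      case False
      then obtain w t where w: "w \<in> {..<K} \<rightarrow> V" and t: "t < K"
        and eq: "\<chi> (\<Theta> (\<Omega> (w(t := x)))) = \<chi> (\<Theta> (\<Omega> (w(t := y))))"
        unfolding separates_def by auto
      define l where "l = t * Suc s"
      have pat_upd: "pat (w(t := a)) = (pat w)(l + s := a)" for a
      proof
        fix j
        show "pat (w(t := a)) j = ((pat w)(l + s := a)) j"
          using site_div[of t] site_mod[of t] div_mult_mod_eq[of j "Suc s"]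
          unfolding pat_def l_def by auto
      qed
      have patV: "pat w \<in> {..<N} \<rightarrow> V"
        using w yV by (auto simp: pat_def N_def less_mult_imp_div_less Pi_iff)
      have run: "pat w j = y" if "l \<le> j" "j < l + s" for j
      proof -
        have "j mod Suc s = (j - l) mod Suc s" using that unfolding l_def by (metis mod_mult_self3 le_add_diff_inverse)
        then have "j mod Suc s \<noteq> s" using that by simp
        then show ?thesis by (simp add: pat_def)
      qed
      have lN: "l + s < N" using site[OF t] by (simp add: l_def)
      obtain \<Psi> where \<Psi>: "subcube V (N + k) k \<Psi>"
        and lower: "\<And>T. T \<subseteq> {..<k} \<Longrightarrow> card T = s \<Longrightarrow>
          \<exists>A \<in> nsets {..<N + k} N. \<Psi> (\<lambda>j. if j \<in> T then y else x) = place x A ((pat w)(l + s := x))"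
        and upper: "\<And>T. T \<subseteq> {..<k} \<Longrightarrow> card T = Suc s \<Longrightarrow>
          \<exists>A \<in> nsets {..<N + k} N. \<Psi> (\<lambda>j. if j \<in> T then y else x) = place x A ((pat w)(l + s := y))"
        using layer_in_words[OF xV yV patV run lN, where k = k] by blast
      have initial: "{..<N} \<in> nsets {..<N + k} N" by (auto simp: nsets_def)
      have col: "\<chi> (\<Theta> (place x A ((pat w)(l + s := a)))) = \<chi> (\<Theta> (\<Omega> (w(t := a))))"
        if "A \<in> nsets {..<N + k} N" "a \<in> V" for A a
        unfolding \<Omega>_def pat_upd using patV that initial by (intro hom) auto
      have "(\<chi> \<circ> \<Theta>) (\<Psi> (\<lambda>j. if j \<in> T then y else x)) = \<chi> (\<Theta> (\<Omega> (w(t := x))))"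
        if "T \<subseteq> {..<k}" "card T = s \<or> card T = Suc s" for T
        using that(2)
      proof
        assume "card T = s"
        then show ?thesis using lower[OF that(1)] col xV by auto
      next
        assume "card T = Suc s"
        then show ?thesis using upper[OF that(1)] col yV eq by auto
      qed
      then have "mono_layer V E (N + k) k s (\<chi> \<circ> \<Theta>)"
        unfolding mono_layer_def using \<Psi> E(1) by blast
      then show ?thesis using mono_layer_subcube[OF \<Theta>] by blast
    qed
  qed
  then show ?thesis by blast
qed

text \<open>
  To treat one more edge with \<open>K\<close> free coordinates in the end, the earlier edges are first separated
  in a subcube of the dimension \<open>m\<close> that \<open>separate_edge\<close> asks for; hence \<open>K\<close> varies in the
  induction.
\<close>

lemma separate_edges:
  assumes V: "finite V" and E: "E \<subseteq> V \<times> V" and F: "F \<subseteq> E" and v: "v \<in> V"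
  shows "\<exists>n. \<forall>\<chi> \<in> ({..<n} \<rightarrow> V) \<rightarrow> {..<r}. mono_layer V E n k s \<chi> \<or>
           (\<exists>\<Phi>. subcube V n K \<Phi> \<and> (\<forall>e \<in> F. separates V K (\<chi> \<circ> \<Phi>) e))"
proof -
  have "finite F" using V E F by (meson finite_SigmaI finite_subset)
  then show ?thesis
    using F
  proof (induction F arbitrary: K rule: finite_induct)
    case empty
    then show ?case using subcube_id[OF v] by blast
  next
    case (insert e F)
    obtain x y where e: "e = (x, y)" by (cases e)
    have xyE: "(x, y) \<in> E" using insert.prems e by simp
    obtain m where m: "\<forall>\<chi> \<in> ({..<m} \<rightarrow> V) \<rightarrow> {..<r}. mono_layer V E m k s \<chi> \<or>
           (\<exists>\<Phi>. subcube V m K \<Phi> \<and> separates V K (\<chi> \<circ> \<Phi>) e)"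
      using separate_edge[OF V xyE E, of r k s K] unfolding e by (rule exE)
    have "F \<subseteq> E" using insert.prems by simp
    from insert.IH[OF this, of m] obtain n where n: "\<forall>\<chi> \<in> ({..<n} \<rightarrow> V) \<rightarrow> {..<r}. mono_layer V E n k s \<chi> \<or>
           (\<exists>\<Phi>. subcube V n m \<Phi> \<and> (\<forall>e \<in> F. separates V m (\<chi> \<circ> \<Phi>) e))"
      by (rule exE)
    have "\<exists>\<Phi>. subcube V n K \<Phi> \<and> (\<forall>e' \<in> insert e F. separates V K (\<chi> \<circ> \<Phi>) e')"
      if \<chi>: "\<chi> \<in> ({..<n} \<rightarrow> V) \<rightarrow> {..<r}" and no: "\<not> mono_layer V E n k s \<chi>" for \<chi>
    proof -
      obtain \<Phi> where \<Phi>: "subcube V n m \<Phi>" "\<And>e. e \<in> F \<Longrightarrow> separates V m (\<chi> \<circ> \<Phi>) e"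
        using bspec[OF n \<chi>] no by blast
      have "\<chi> \<circ> \<Phi> \<in> ({..<m} \<rightarrow> V) \<rightarrow> {..<r}"
      proof
        fix w assume "w \<in> {..<m} \<rightarrow> V"
        then have "\<Phi> w \<in> {..<n} \<rightarrow> V" by (rule subcube_words[OF \<Phi>(1)])
        then show "(\<chi> \<circ> \<Phi>) w \<in> {..<r}" using Pi_mem[OF \<chi>] by simp
      qed
      from bspec[OF m this] obtain \<Phi>' where \<Phi>': "subcube V m K \<Phi>'" "separates V K (\<chi> \<circ> \<Phi> \<circ> \<Phi>') e"
        using no mono_layer_subcube[OF \<Phi>(1)] by blast
      then show ?thesis
        using subcube_comp[OF \<Phi>(1) \<Phi>'(1)] separates_subcube[OF \<Phi>'(1) \<Phi>(2)]
        by (intro exI[of _ "\<Phi> \<circ> \<Phi>'"]) (auto simp: comp_assoc)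
    qed
    then show ?case by blast
  qed
qed

section \<open>Layered graphs in Cartesian powers\<close>

lemma parcs_cart_power:
  assumes "pair_graph G"
  shows "(xs, ys) \<in> parcs (cart_power G n) \<longleftrightarrow>
    xs \<in> pverts (cart_power G n) \<and> ys \<in> pverts (cart_power G n) \<and>
    (\<exists>i<n. (xs ! i, ys ! i) \<in> parcs G \<and> (\<forall>j<n. j \<noteq> i \<longrightarrow> xs ! j = ys ! j))"
proof (induction n arbitrary: xs ys)
  case 0
  then show ?case by simp
next
  case (Suc n)
  interpret pair_graph G by fact
  show ?case
  proof (cases "length xs = Suc n \<and> length ys = Suc n")
    case False
    moreover have "(xs, ys) \<notin> parcs (cart_power G (Suc n))"
    proof -
      interpret P: pair_graph "cart_power G (Suc n)" using assms by (rule pair_graph_cart_power)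
      show ?thesis using False P.in_arcsD1[of xs ys] P.in_arcsD2[of xs ys] unfolding pverts_cart_power by blast
    qed
    ultimately show ?thesis unfolding pverts_cart_power by blast
  next
    case True
    then obtain us u vs v where d: "xs = us @ [u]" "ys = vs @ [v]" "length us = n" "length vs = n"
      by (metis length_Suc_conv_rev)
    have "(xs, ys) \<in> parcs (cart_power G (Suc n)) \<longleftrightarrow>
       us \<in> pverts (cart_power G n) \<and> vs \<in> pverts (cart_power G n) \<and> u \<in> pverts G \<and> v \<in> pverts G \<and>
       ((us, vs) \<in> parcs (cart_power G n) \<and> u = v \<or> us = vs \<and> (u, v) \<in> parcs G)"
      by (force simp: d relabel_def cart_prod_def image_iff)
    also have "\<dots> \<longleftrightarrow> xs \<in> pverts (cart_power G (Suc n)) \<and> ys \<in> pverts (cart_power G (Suc n)) \<and>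
       ((us, vs) \<in> parcs (cart_power G n) \<and> u = v \<or> us = vs \<and> (u, v) \<in> parcs G)"
      unfolding pverts_cart_power using d by auto
    also have "\<dots> \<longleftrightarrow> xs \<in> pverts (cart_power G (Suc n)) \<and> ys \<in> pverts (cart_power G (Suc n)) \<and>
       (\<exists>i<Suc n. (xs ! i, ys ! i) \<in> parcs G \<and> (\<forall>j<Suc n. j \<noteq> i \<longrightarrow> xs ! j = ys ! j))"
    proof (intro conj_cong refl iffI)
      assume xs: "xs \<in> pverts (cart_power G (Suc n))" and ys: "ys \<in> pverts (cart_power G (Suc n))"
      have us: "us \<in> pverts (cart_power G n)" "vs \<in> pverts (cart_power G n)"
        using xs ys d unfolding pverts_cart_power by auto
      have n: "xs ! n = u" "ys ! n = v" and less: "\<And>i. i < n \<Longrightarrow> xs ! i = us ! i \<and> ys ! i = vs ! i"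
        using d by (auto simp: nth_append)
      {
        assume "(us, vs) \<in> parcs (cart_power G n) \<and> u = v \<or> us = vs \<and> (u, v) \<in> parcs G"
        then show "\<exists>i<Suc n. (xs ! i, ys ! i) \<in> parcs G \<and> (\<forall>j<Suc n. j \<noteq> i \<longrightarrow> xs ! j = ys ! j)"
        proof (elim disjE conjE)
          assume "(us, vs) \<in> parcs (cart_power G n)" "u = v"
          then obtain i where "i < n" "(us ! i, vs ! i) \<in> parcs G" "\<And>j. j < n \<Longrightarrow> j \<noteq> i \<Longrightarrow> us ! j = vs ! j"
            unfolding Suc.IH by blast
          with \<open>u = v\<close> show ?thesis using n less by (intro exI[of _ i]) (auto simp: less_Suc_eq)
        next
          assume "us = vs" "(u, v) \<in> parcs G"
          then show ?thesis using n less by (intro exI[of _ n]) (auto simp: less_Suc_eq)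
        qed
      next
        assume "\<exists>i<Suc n. (xs ! i, ys ! i) \<in> parcs G \<and> (\<forall>j<Suc n. j \<noteq> i \<longrightarrow> xs ! j = ys ! j)"
        then obtain i where i: "i < Suc n" "(xs ! i, ys ! i) \<in> parcs G"
          "\<And>j. j < Suc n \<Longrightarrow> j \<noteq> i \<Longrightarrow> xs ! j = ys ! j" by blast
        show "(us, vs) \<in> parcs (cart_power G n) \<and> u = v \<or> us = vs \<and> (u, v) \<in> parcs G"
        proof (cases "i = n")
          case True
          have "us = vs"
          proof (rule nth_equalityI)
            fix j assume "j < length us"
            then show "us ! j = vs ! j" using less[of j] i(3)[of j] d(3) True by auto
          qed (use d in simp)
          then show ?thesis using i(2) True n by simp
        next
          case False
          then have "i < n" using i(1) by simp
          moreover have "us ! j = vs ! j" if "j < n" "j \<noteq> i" for j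
            using less[of j] i(3)[of j] that by auto
          ultimately have "(us, vs) \<in> parcs (cart_power G n)"
            unfolding Suc.IH using us i(2) less by auto
          then show ?thesis using i(3)[of n] False n by auto
        qed
      }
    qed
    finally show ?thesis .
  qed
qed

lemma subgraph_copy:
  fixes S :: "('a, 'a \<times> 'a) pre_digraph" and F :: "'c pair_pre_digraph"
  assumes S: "wf_digraph S" "tail S = fst" "head S = snd" and F: "pair_graph F"
    and inj: "inj_on \<phi> (verts S)" and verts: "\<phi> ` verts S \<subseteq> pverts F"
    and arcs: "\<And>u v. (u, v) \<in> arcs S \<Longrightarrow> (\<phi> u, \<phi> v) \<in> parcs F"
  obtains S' where "subgraph S' (with_proj F)" "digraph_iso S S'" "verts S' = \<phi> ` verts S"
proof -
  interpret S: wf_digraph S by fact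
  interpret F: pair_graph F by fact
  define h where "h = \<lparr>iso_verts = \<phi>, iso_arcs = map_prod \<phi> \<phi>, iso_head = snd, iso_tail = fst\<rparr>"
  have "arcs S \<subseteq> verts S \<times> verts S"
    using S.tail_in_verts S.head_in_verts S(2,3) by fastforce
  then have "inj_on (map_prod \<phi> \<phi>) (arcs S)"
    by (rule inj_on_subset[OF map_prod_inj_on[OF inj inj]])
  then have h: "pre_digraph.digraph_isomorphism S h"
    unfolding pre_digraph.digraph_isomorphism_def h_def using S inj by simp
  moreover have "subgraph (app_iso h S) (with_proj F)"
    unfolding subgraph_def
  proof (intro conjI)
    show "verts (app_iso h S) \<subseteq> verts (with_proj F)" using verts by (simp add: h_def)
    show "arcs (app_iso h S) \<subseteq> arcs (with_proj F)" using arcs by (auto simp: h_def)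
    show "wf_digraph (with_proj F)" by unfold_locales
    show "wf_digraph (app_iso h S)" using h by (rule S.wf_digraphI_app_iso)
    show "compatible (with_proj F) (app_iso h S)" by (simp add: compatible_def h_def)
  qed
  moreover have "digraph_iso S (app_iso h S)" using h unfolding digraph_iso_def by blast
  moreover have "verts (app_iso h S) = \<phi> ` verts S" by (simp add: h_def)
  ultimately show thesis using that by blast
qed

lemma pair_graph_K2: "pair_graph K2"
  by unfold_locales (auto simp: K2_def symmetric_def sym_def)

lemma vertex_layer_ones:
  assumes "v \<in> vertex_layer k i"
  shows "v \<in> pverts (hypercube k)" "length v = k" "set v \<subseteq> {0, 1}" "card {j. j < k \<and> v ! j = 1} = i"
proof -
  show v: "v \<in> pverts (hypercube k)" using assms by (simp add: vertex_layer_def)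
  then show len: "length v = k" "set v \<subseteq> {0, 1}"
    by (auto simp: hypercube_def pverts_cart_power K2_def)
  show "card {j. j < k \<and> v ! j = 1} = i"
    using assms len(1)
    by (simp add: vertex_layer_def count_list_eq_length_filter length_filter_conv_card eq_commute)
qed

text \<open>
  Reading the bits of a vertex of \<open>Q\<^sub>k\<close> as a choice between \<open>x\<close> and \<open>y\<close> at the free coordinates maps
  edges to edges, since flipping one bit changes one coordinate along the edge \<open>xy\<close>.
\<close>

lemma layered_copy:
  assumes G: "pair_graph G" and E: "(x, y) \<in> parcs G" and \<Psi>: "subcube (pverts G) n k \<Psi>"
    and S: "subgraph S (edge_layer k s)"
    and mono: "\<And>T. T \<subseteq> {..<k} \<Longrightarrow> card T = s \<or> card T = Suc s \<Longrightarrow>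
        c (map (\<Psi> (\<lambda>j. if j \<in> T then y else x)) [0..<n]) = col"
  obtains S' where "subgraph S' (with_proj (cart_power G n))" "digraph_iso S S'"
    "\<And>v. v \<in> verts S' \<Longrightarrow> c v = col"
proof -
  interpret G: pair_graph G by fact
  have xV: "x \<in> pverts G" and yV: "y \<in> pverts G" and yx: "(y, x) \<in> parcs G" and "x \<noteq> y"
    using E G.in_arcsD1 G.in_arcsD2 G.arcs_symmetric G.no_loops' by auto
  obtain p b where p: "inj_on p {..<k}" "p \<in> {..<k} \<rightarrow> {..<n}"
    "\<And>w t. t < k \<Longrightarrow> \<Psi> w (p t) = w t" "\<And>w i. i \<notin> p ` {..<k} \<Longrightarrow> \<Psi> w i = b i"
    by (rule subcubeE[OF \<Psi>]) blast
  define ones where "ones v = {j. j < k \<and> v ! j = (1::nat)}" for v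
  define word where "word v = \<Psi> (\<lambda>j. if j \<in> ones v then y else x)" for v
  define \<phi> where "\<phi> v = map (word v) [0..<n]" for v
  have word_p: "word v (p j) = (if v ! j = 1 then y else x)" if "j < k" for v j
    using that p(3) by (simp add: word_def ones_def)
  have \<phi>_p: "\<phi> v ! p j = (if v ! j = 1 then y else x)" if "j < k" for v j
    using that p(2) word_p by (auto simp: \<phi>_def Pi_iff)
  have vS: "v \<in> vertex_layer k s \<or> v \<in> vertex_layer k (Suc s)" if "v \<in> verts S" for v
    using S that by (auto simp: subgraph_def edge_layer_def)
  have wfS: "wf_digraph S" and tS: "tail S = fst" and hS: "head S = snd"
    using S by (auto simp: subgraph_def edge_layer_def compatible_def)
  interpret S: wf_digraph S by (fact wfS)
  have aS: "(u, v) \<in> parcs (hypercube k)" if "(u, v) \<in> arcs S" for u v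
    using S that by (auto simp: subgraph_def edge_layer_def)
  have vV: "\<phi> v \<in> pverts (cart_power G n)" for v
  proof -
    have "word v \<in> {..<n} \<rightarrow> pverts G"
      unfolding word_def using \<Psi> by (rule subcube_words) (use xV yV in auto)
    then show ?thesis by (auto simp: \<phi>_def pverts_cart_power)
  qed
  have bits: "length v = k" "j < k \<Longrightarrow> v ! j = 0 \<or> v ! j = 1" if "v \<in> verts S" for v j
  proof -
    show "length v = k" using vS[OF that] vertex_layer_ones(2) by blast
    moreover have "set v \<subseteq> {0, 1}" using vS[OF that] vertex_layer_ones(3) by blast
    ultimately show "j < k \<Longrightarrow> v ! j = 0 \<or> v ! j = 1" using nth_mem by blast
  qed
  have inj: "inj_on \<phi> (verts S)"
  proof (rule inj_onI)
    fix u v assume u: "u \<in> verts S" and v: "v \<in> verts S" and eq: "\<phi> u = \<phi> v"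
    have "u ! j = v ! j" if "j < k" for j
      using \<phi>_p[OF that, of u] \<phi>_p[OF that, of v] eq \<open>x \<noteq> y\<close> bits(2)[OF u that] bits(2)[OF v that]
      by (auto split: if_splits)
    then show "u = v" using bits(1)[OF u] bits(1)[OF v] by (simp add: list_eq_iff_nth_eq)
  qed
  have arcs: "(\<phi> u, \<phi> v) \<in> parcs (cart_power G n)" if uv: "(u, v) \<in> arcs S" for u v
  proof -
    obtain i where i: "i < k" "(u ! i, v ! i) \<in> parcs K2" "\<And>j. j < k \<Longrightarrow> j \<noteq> i \<Longrightarrow> u ! j = v ! j"
      using aS[OF uv] unfolding hypercube_def parcs_cart_power[OF pair_graph_K2] by blast
    have pi: "p i < n" using p(2) i(1) by auto
    have "(\<phi> u ! p i, \<phi> v ! p i) \<in> parcs G"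
      using i(1,2) E yx by (auto simp: \<phi>_p K2_def)
    moreover have "\<phi> u ! m = \<phi> v ! m" if m: "m < n" "m \<noteq> p i" for m
    proof (cases "m \<in> p ` {..<k}")
      case True
      then obtain j where "j < k" "m = p j" by auto
      moreover from this have "j \<noteq> i" using m by auto
      ultimately show ?thesis using i(3)[of j] by (simp add: \<phi>_p)
    next
      case False
      then show ?thesis using m p(4) by (simp add: \<phi>_def word_def)
    qed
    ultimately show ?thesis
      unfolding parcs_cart_power[OF G] using vV pi by blast
  qed
  have col: "c (\<phi> v) = col" if "v \<in> verts S" for v
    unfolding \<phi>_def word_def
  proof (rule mono)
    show "ones v \<subseteq> {..<k}" by (auto simp: ones_def)
    show "card (ones v) = s \<or> card (ones v) = Suc s"
      using vS[OF that] vertex_layer_ones(4) unfolding ones_def by blast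
  qed
  have verts: "\<phi> ` verts S \<subseteq> pverts (cart_power G n)" using vV by blast
  obtain S' where S': "subgraph S' (with_proj (cart_power G n))" "digraph_iso S S'"
    and vS': "verts S' = \<phi> ` verts S"
    by (rule subgraph_copy[OF wfS tS hS pair_graph_cart_power[OF G, of n] inj verts arcs])
  show thesis by (rule that[OF S']) (use vS' col in auto)
qed

theorem theorem1:
  fixes H :: "'b pair_pre_digraph" and G :: "'a pair_pre_digraph" and r :: nat
  assumes "pair_graph H" and "layered H"
    and "r > 0"
    and "pair_graph G" and "chromatic_number G = r + 1"
  shows "\<exists>n>0. vertex_arrows (cart_power G n) r H"
proof -
  interpret G: pair_graph G by fact
  obtain k s S where k: "k > 0" and S: "subgraph S (edge_layer k s)" and HS: "digraph_iso (with_proj H) S"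
    using assms(2) unfolding layered_def by blast
  let ?V = "pverts G" and ?E = "parcs G"
  have no_col: "\<not> proper_coloring G r c" for c
  proof
    assume "proper_coloring G r c"
    then have "chromatic_number G \<le> r" unfolding chromatic_number_def by (intro Least_le) blast
    then show False using assms(5) by simp
  qed
  have "?E \<noteq> {}"
    using no_col[of "\<lambda>_. 0"] assms(3) by (auto simp: proper_coloring_def)
  then obtain v where v: "v \<in> ?V" using G.in_arcsD1 by auto
  have E: "?E \<subseteq> ?V \<times> ?V" using G.in_arcsD1 G.in_arcsD2 by auto
  obtain n where n: "\<And>\<chi>. \<chi> \<in> ({..<n} \<rightarrow> ?V) \<rightarrow> {..<r} \<Longrightarrow> mono_layer ?V ?E n k s \<chi> \<or>
           (\<exists>\<Phi>. subcube ?V n 1 \<Phi> \<and> (\<forall>e \<in> ?E. separates ?V 1 (\<chi> \<circ> \<Phi>) e))"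
    using separate_edges[OF G.pair_finite_verts E subset_refl v, of r k s 1] by blast
  (* otherwise the colors seen at the one free coordinate form a proper coloring of G *)
  have mono: "mono_layer ?V ?E n k s \<chi>" if \<chi>: "\<chi> \<in> ({..<n} \<rightarrow> ?V) \<rightarrow> {..<r}" for \<chi>
  proof (rule ccontr)
    assume "\<not> mono_layer ?V ?E n k s \<chi>"
    then obtain \<Phi> where \<Phi>: "subcube ?V n 1 \<Phi>" and sep: "\<And>e. e \<in> ?E \<Longrightarrow> separates ?V 1 (\<chi> \<circ> \<Phi>) e"
      using n[OF \<chi>] by blast
    define f where "f u = \<chi> (\<Phi> (\<lambda>_. u))" for u
    have "f u \<in> {..<r}" if "u \<in> ?V" for u
      unfolding f_def using \<chi> subcube_words[OF \<Phi>, of "\<lambda>_. u"] that by blast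
    moreover have "f a \<noteq> f b" if "(a, b) \<in> ?E" for a b
    proof -
      have "a \<in> ?V" using that E by auto
      then have "\<chi> (\<Phi> ((\<lambda>_. a)(0 := a))) \<noteq> \<chi> (\<Phi> ((\<lambda>_. a)(0 := b)))"
        using sep[OF that] unfolding separates_def by auto
      moreover have "\<Phi> ((\<lambda>_. a)(0 := b)) = \<Phi> (\<lambda>_. b)"
        using \<Phi> by (rule subcube_cong) simp
      ultimately show ?thesis by (simp add: f_def fun_upd_idem)
    qed
    ultimately have "proper_coloring G r f" by (auto simp: proper_coloring_def)
    then show False using no_col by blast
  qed
  (* a layer has k > 0 free coordinates, all of them below n, and a constant coloring provides one *)
  have "n > 0"
  proof -
    have "mono_layer ?V ?E n k s (\<lambda>_. 0)" using assms(3) by (intro mono) auto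
    then obtain \<Psi> where \<Psi>: "subcube ?V n k \<Psi>" unfolding mono_layer_def by (elim exE conjE)
    obtain p where "p \<in> {..<k} \<rightarrow> {..<n}" using \<Psi> by (rule subcubeE)
    then have "p 0 < n" using k by (auto simp: Pi_iff)
    then show ?thesis by simp
  qed
  moreover have "vertex_arrows (cart_power G n) r H"
    unfolding vertex_arrows_def
  proof
    fix c assume c: "c \<in> pverts (cart_power G n) \<rightarrow> {..<r}"
    define \<chi> where "\<chi> w = c (map w [0..<n])" for w
    have \<chi>: "\<chi> \<in> ({..<n} \<rightarrow> ?V) \<rightarrow> {..<r}"
    proof
      fix w assume "w \<in> {..<n} \<rightarrow> ?V"
      then have "map w [0..<n] \<in> pverts (cart_power G n)" by (auto simp: pverts_cart_power)
      then show "\<chi> w \<in> {..<r}" unfolding \<chi>_def using c by blast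
    qed
    obtain \<Psi> x y col where \<Psi>: "subcube ?V n k \<Psi>" and xy: "(x, y) \<in> ?E"
      and col: "\<And>T. T \<subseteq> {..<k} \<Longrightarrow> card T = s \<or> card T = Suc s \<Longrightarrow>
        c (map (\<Psi> (\<lambda>j. if j \<in> T then y else x)) [0..<n]) = col"
      using mono[OF \<chi>] unfolding mono_layer_def \<chi>_def by blast
    obtain S' where S': "subgraph S' (with_proj (cart_power G n))" "digraph_iso S S'"
      and mcol: "\<And>v. v \<in> verts S' \<Longrightarrow> c v = col"
      by (rule layered_copy[OF assms(4) xy \<Psi> S, where c = c and col = col]) (use col in blast)+
    have iso: "digraph_iso (with_proj H) S'" using HS S'(2) by (rule digraph_iso_trans)
    have "\<exists>k<r. \<forall>v \<in> verts S'. c v = k"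
    proof (cases "verts S' = {}")
      case True
      then show ?thesis using assms(3) by auto
    next
      case False
      then obtain u where u: "u \<in> verts S'" by auto
      then have "u \<in> pverts (cart_power G n)" using S'(1) by (auto simp: subgraph_def)
      then have "col < r" using c mcol[OF u] by auto
      then show ?thesis using mcol by blast
    qed
    then show "\<exists>S. subgraph S (with_proj (cart_power G n)) \<and> digraph_iso (with_proj H) S \<and>
            (\<exists>k<r. \<forall>v \<in> verts S. c v = k)"
      using S'(1) iso by blast
  qed
  ultimately show ?thesis by blast
qed

end
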